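(* Let $X$ be a simplicial complex on a linearly ordered vertex set and let $\prec$ be a linear ordering of the maximal simplices of $X$. Then $$\mathcal{M}_0(X)\leq d(X,\prec),$$ where $\mathcal{M}_0(X)$ and $d(X,\prec)$ are defined in the context.
   Context: Simplicial complexes are finite. For a vertex $v$ of $X$, $\mathrm{lk}(v,X)=\{\tau\in X:v\notin\tau,\ \tau\cup\{v\}\in X\}$ and $\mathrm{del}(v,X)=\{\tau\in X:v\notin\tau\}$. Let $X^o$ be the set of vertices $v$ of $X$ with $\mathrm{lk}(v,X)\neq\mathrm{del}(v,X)$. Define recursively $\mathcal{M}_0(X)=0$ if $X^o=\emptyset$, and otherwise $\mathcal{M}_0(X)=\min_{v\in X^o}\max\{\mathcal{M}_0(\mathrm{lk}(v,X))+1,\ \mathcal{M}_0(\mathrm{del}(v,X))\}$. Let the vertex set of $X$ be linearly ordered and let $\prec:\gamma_1,\dots,\gamma_m$ be a linear ordering of the maximal simplices of $X$. For $\gamma\in X$, the minimal exclusion sequence $\mathrm{mes}(\gamma,\prec)$ is defined as follows. Let $j$ be the smallest index with $\gamma\subseteq\gamma_j$. If $j=1$, then $\mathrm{mes}(\gamma,\prec)$ is the null sequence. If $j\ge2$, then $\mathrm{mes}(\gamma,\prec)=(v_1,\dots,v_{j-1})$ where $v_1=\min(\gamma\setminus\gamma_1)$ and, for $k\in\{2,\dots,j-1\}$, $v_k=\min(\{v_1,\dots,v_{k-1}\}\cap(\gamma\setminus\gamma_k))$ if $\{v_1,\dots,v_{k-1}\}\cap(\gamma\setminus\gamma_k)\ne\emptyset$,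 and $v_k=\min(\gamma\setminus\gamma_k)$ otherwise. Let $M(\gamma,\prec)$ be the set of vertices appearing in $\mathrm{mes}(\gamma,\prec)$, and $d(X,\prec)=\max_{\gamma\in X}|M(\gamma,\prec)|$. *)

theory Defs
  imports Main
begin

text \<open>Abstract simplicial complexes contain the empty simplex, apart from the void complex
  \<open>{}\<close>, which is admitted as well. The vertices of a complex are the elements of its simplices.\<close>

definition simplicial_complex :: "'a set set \<Rightarrow> bool" where
  "simplicial_complex X \<longleftrightarrow>
     finite X \<and> (\<forall>\<sigma>\<in>X. finite \<sigma>) \<and> (\<forall>\<sigma>\<in>X. \<forall>\<tau>. \<tau> \<subseteq> \<sigma> \<longrightarrow> \<tau> \<in> X)"

definition vertices :: "'a set set \<Rightarrow> 'a set" where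
  "vertices X = \<Union>X"

definition maximal_simplices :: "'a set set \<Rightarrow> 'a set set" where
  "maximal_simplices X = {\<sigma> \<in> X. \<forall>\<tau>\<in>X. \<sigma> \<subseteq> \<tau> \<longrightarrow> \<tau> = \<sigma>}"

definition lk :: "'a \<Rightarrow> 'a set set \<Rightarrow> 'a set set" where
  "lk v X = {\<tau> \<in> X. v \<notin> \<tau> \<and> insert v \<tau> \<in> X}"

definition del :: "'a \<Rightarrow> 'a set set \<Rightarrow> 'a set set" where
  "del v X = {\<tau> \<in> X. v \<notin> \<tau>}"

text \<open>The set written \<open>X\<^sup>o\<close>: the vertices that are not cone points.\<close>

definition non_cone_vertices :: "'a set set \<Rightarrow> 'a set" where
  "non_cone_vertices X = {v \<in> vertices X. lk v X \<noteq> del v X}"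

text \<open>The value on infinite families is a dummy that makes the recursion total;
  it is never reached from a simplicial complex.\<close>

function M0 :: "'a set set \<Rightarrow> nat" where
  "M0 X =
     (if infinite X \<or> non_cone_vertices X = {} then 0
      else Min ((\<lambda>v. max (M0 (lk v X) + 1) (M0 (del v X))) ` non_cone_vertices X))"
  by pat_completeness auto
termination
proof (relation "measure card")
  fix X :: "'a set set" and v
  assume "\<not> (infinite X \<or> non_cone_vertices X = {})" and "v \<in> non_cone_vertices X"
  then have "finite X" "lk v X \<subset> X" "del v X \<subset> X"
    by (auto simp: non_cone_vertices_def vertices_def lk_def del_def)
  then show "(lk v X, X) \<in> measure card" "(del v X, X) \<in> measure card"
    by (auto intro: psubset_card_mono)
qed simp

declare M0.simps [simp del]

text \<open>\<open>mes_extend \<gamma> vs [\<gamma>\<^sub>k, \<dots>, \<gamma>\<^sub>l]\<close> appends \<open>v\<^sub>k, \<dots>, v\<^sub>l\<close> to the sequence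
  \<open>vs = [v\<^sub>1, \<dots>, v\<^sub>k\<^sub>-\<^sub>1]\<close>. For \<open>vs = []\<close> the second branch applies and yields
  \<open>v\<^sub>1 = min (\<gamma> - \<gamma>\<^sub>1)\<close>.\<close>

fun mes_extend :: "'a::linorder set \<Rightarrow> 'a list \<Rightarrow> 'a set list \<Rightarrow> 'a list" where
  "mes_extend \<gamma> vs [] = vs"
| "mes_extend \<gamma> vs (\<sigma> # \<sigma>s) =
     mes_extend \<gamma>
       (vs @ [if set vs \<inter> (\<gamma> - \<sigma>) \<noteq> {} then Min (set vs \<inter> (\<gamma> - \<sigma>)) else Min (\<gamma> - \<sigma>)]) \<sigma>s"

text \<open>A linear ordering of the maximal simplices is the list \<open>[\<gamma>\<^sub>1, \<dots>, \<gamma>\<^sub>m]\<close>. If \<open>j\<close> is the smallest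
  index with \<open>\<gamma> \<subseteq> \<gamma>\<^sub>j\<close>, then the \<open>takeWhile\<close> prefix is \<open>[\<gamma>\<^sub>1, \<dots>, \<gamma>\<^sub>j\<^sub>-\<^sub>1]\<close>.\<close>

definition mes :: "'a::linorder set \<Rightarrow> 'a set list \<Rightarrow> 'a list" where
  "mes \<gamma> \<gamma>s = mes_extend \<gamma> [] (takeWhile (\<lambda>\<sigma>. \<not> \<gamma> \<subseteq> \<sigma>) \<gamma>s)"

definition mes_vertices :: "'a::linorder set \<Rightarrow> 'a set list \<Rightarrow> 'a set" where
  "mes_vertices \<gamma> \<gamma>s = set (mes \<gamma> \<gamma>s)"

definition mes_dim :: "'a::linorder set set \<Rightarrow> 'a set list \<Rightarrow> nat" where
  "mes_dim X \<gamma>s = Max ((\<lambda>\<gamma>. card (mes_vertices \<gamma> \<gamma>s)) ` X)"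

definition maximal_simplex_order :: "'a set set \<Rightarrow> 'a set list \<Rightarrow> bool" where
  "maximal_simplex_order X \<gamma>s \<longleftrightarrow> distinct \<gamma>s \<and> set \<gamma>s = maximal_simplices X"

end

theory Submission imports Defs begin

text \<open>The inequality holds more generally for every list \<open>\<gamma>\<^sub>1, \<dots>, \<gamma>\<^sub>m\<close> of simplices, maximal or not, that
  generates \<open>X\<close>; this form passes to links and deletions. If \<open>X\<close> is not the full simplex on \<open>\<gamma>\<^sub>1\<close>,
  let \<open>v\<close> be the least vertex outside \<open>\<gamma>\<^sub>1\<close>. Deleting \<open>v\<close> from all generators leaves the
  sequences of the simplices avoiding \<open>v\<close> unchanged. For \<open>\<gamma>\<close> in the link of \<open>v\<close>, the
  sequence of \<open>\<gamma> \<union> {v}\<close> starts with \<open>v\<close>; hence generators avoiding \<open>v\<close> contribute no new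
  vertex, and the others contribute exactly as they do for \<open>\<gamma>\<close> in the link. So \<open>M0 X \<le> d\<close> follows by
  induction from the bound \<open>d - 1\<close> for the link and \<open>d\<close> for the deletion. If \<open>v\<close> is a cone point, then
  \<open>M0\<close> of \<open>X\<close> and of the deletion agree.\<close>

section \<open>Complexes generated by a list of simplices\<close>

definition generated_complex :: "'a set list \<Rightarrow> 'a set set" where
  "generated_complex L = {\<tau>. \<exists>\<sigma>\<in>set L. \<tau> \<subseteq> \<sigma>}"

lemma finite_generated_complex:
  assumes "\<forall>\<sigma>\<in>set L. finite \<sigma>"
  shows "finite (generated_complex L)"
proof -
  have "generated_complex L = (\<Union>\<sigma>\<in>set L. Pow \<sigma>)"
    by (auto simp: generated_complex_def)
  then show ?thesis using assms by simp
qed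

lemma generated_complex_eq_complex:
  assumes "simplicial_complex X" and "set L = maximal_simplices X"
  shows "generated_complex L = X"
proof
  show "generated_complex L \<subseteq> X"
    using assms
    unfolding generated_complex_def maximal_simplices_def simplicial_complex_def by blast
  show "X \<subseteq> generated_complex L"
  proof
    fix \<tau> assume "\<tau> \<in> X"
    moreover have "finite X"
      using assms by (simp add: simplicial_complex_def)
    ultimately obtain \<sigma> where "\<sigma> \<in> X" "\<tau> \<subseteq> \<sigma>" "\<forall>\<rho>\<in>X. \<sigma> \<subseteq> \<rho> \<longrightarrow> \<sigma> = \<rho>"
      using finite_has_maximal2 by metis
    then show "\<tau> \<in> generated_complex L"
      using assms by (auto simp: generated_complex_def maximal_simplices_def)
  qed
qed

lemma del_generated_complex:
  "del v (generated_complex L) = generated_complex (map (\<lambda>\<sigma>. \<sigma> - {v}) L)"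
  by (auto simp: generated_complex_def del_def)

lemma lk_generated_complex:
  "lk v (generated_complex L) =
    generated_complex (map (\<lambda>\<sigma>. \<sigma> - {v}) (filter (\<lambda>\<sigma>. v \<in> \<sigma>) L))"
  by (auto simp: generated_complex_def lk_def)

section \<open>Links, deletions and cone points\<close>

lemma lk_lk_commute: "u \<noteq> v \<Longrightarrow> lk u (lk v X) = lk v (lk u X)"
  by (auto simp: lk_def insert_commute)

lemma del_del_commute: "del u (del v X) = del v (del u X)"
  by (auto simp: del_def)

lemma lk_del_commute: "u \<noteq> v \<Longrightarrow> lk u (del v X) = del v (lk u X)"
  by (auto simp: lk_def del_def)

lemma M0_le_max:
  assumes "finite X" and v: "v \<in> non_cone_vertices X" and fin: "finite (non_cone_vertices X)"
  shows "M0 X \<le> max (M0 (lk v X) + 1) (M0 (del v X))"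
proof -
  have "M0 X = Min ((\<lambda>v. max (M0 (lk v X) + 1) (M0 (del v X))) ` non_cone_vertices X)"
    using assms by (subst M0.simps) auto
  also have "\<dots> \<le> max (M0 (lk v X) + 1) (M0 (del v X))"
    using v fin by (intro Min_le) auto
  finally show ?thesis .
qed

text \<open>Membership in \<open>X\<close> is insensitive to adding or removing a cone point
  \<open>v\<close>, so the two simplices witnessing that \<open>u\<close> is a non-cone vertex may
  be stripped of \<open>v\<close>. The vertex \<open>v\<close> lies in neither set.\<close>

lemma non_cone_vertices_del_cone_point:
  assumes down: "\<And>\<sigma> \<tau>. \<sigma> \<in> X \<Longrightarrow> \<tau> \<subseteq> \<sigma> \<Longrightarrow> \<tau> \<in> X" and cone: "lk v X = del v X"
  shows "non_cone_vertices (del v X) = non_cone_vertices X"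
proof -
  have ins: "insert v \<tau> \<in> X" if "\<tau> \<in> X" for \<tau>
  proof (cases "v \<in> \<tau>")
    case True
    then show ?thesis using that by (simp add: insert_absorb)
  next
    case False
    then have "\<tau> \<in> lk v X" unfolding cone using that by (simp add: del_def)
    then show ?thesis by (simp add: lk_def)
  qed
  have iff: "insert v \<tau> \<in> X \<longleftrightarrow> \<tau> \<in> X" for \<tau>
    using ins[of \<tau>] down[of "insert v \<tau>" \<tau>] by auto
  have minus_iff: "\<tau> - {v} \<in> X \<longleftrightarrow> \<tau> \<in> X" for \<tau>
    using iff[of "\<tau> - {v}"] iff[of \<tau>] by simp
  have nc: "u \<in> non_cone_vertices Y \<longleftrightarrow>
      (\<exists>\<sigma>\<in>Y. u \<in> \<sigma>) \<and> (\<exists>\<tau>\<in>Y. u \<notin> \<tau> \<and> insert u \<tau> \<notin> Y)" for u :: 'a and Y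
    unfolding non_cone_vertices_def vertices_def lk_def del_def by blast
  have "u \<in> non_cone_vertices (del v X) \<longleftrightarrow> u \<in> non_cone_vertices X" for u
  proof (cases "u = v")
    case True
    then show ?thesis unfolding nc using ins by (auto simp: del_def)
  next
    case False
    show ?thesis
    proof
      assume "u \<in> non_cone_vertices (del v X)"
      then show "u \<in> non_cone_vertices X"
        using False unfolding nc by (auto simp: del_def)
    next
      assume "u \<in> non_cone_vertices X"
      then obtain \<sigma> \<tau> where *: "\<sigma> \<in> X" "u \<in> \<sigma>" "\<tau> \<in> X" "u \<notin> \<tau>" "insert u \<tau> \<notin> X"
        unfolding nc by blast
      have "insert u \<tau> - {v} = insert u (\<tau> - {v})"
        using False by auto
      then have "\<sigma> - {v} \<in> del v X" "\<tau> - {v} \<in> del v X" "insert u (\<tau> - {v}) \<notin> del v X"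
        using * minus_iff[of \<sigma>] minus_iff[of \<tau>] minus_iff[of "insert u \<tau>"]
        by (auto simp: del_def)
      moreover have "u \<in> \<sigma> - {v}" "u \<notin> \<tau> - {v}"
        using * False by auto
      ultimately show "u \<in> non_cone_vertices (del v X)"
        unfolding nc by (intro conjI bexI)
    qed
  qed
  then show ?thesis by blast
qed

text \<open>Both recursions run over the same vertices \<open>u\<close>, all different from
  \<open>v\<close>. Since links and deletions commute, the cone equation for \<open>v\<close> passes
  to \<open>lk u X\<close> and \<open>del u X\<close>, so induction matches the two minima term by
  term.\<close>

lemma M0_del_cone_point:
  assumes "finite X" and "\<And>\<sigma> \<tau>. \<sigma> \<in> X \<Longrightarrow> \<tau> \<subseteq> \<sigma> \<Longrightarrow> \<tau> \<in> X" and "lk v X = del v X"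
  shows "M0 X = M0 (del v X)"
  using assms
proof (induction "card X" arbitrary: X rule: less_induct)
  case less
  have nc: "non_cone_vertices (del v X) = non_cone_vertices X"
    using less.prems(2,3) by (rule non_cone_vertices_del_cone_point)
  have "M0 (lk u X) = M0 (lk u (del v X)) \<and> M0 (del u X) = M0 (del u (del v X))"
    if u: "u \<in> non_cone_vertices X" for u
  proof -
    have "u \<noteq> v"
      using u less.prems(3) by (auto simp: non_cone_vertices_def)
    have "lk u X \<subset> X" "del u X \<subset> X"
      using u by (auto simp: non_cone_vertices_def vertices_def lk_def del_def)
    then have small: "card (lk u X) < card X" "card (del u X) < card X"
      and fin: "finite (lk u X)" "finite (del u X)"
      using less.prems(1) by (auto intro: psubset_card_mono finite_subset)
    have cone: "lk v (lk u X) = del v (lk u X)" "lk v (del u X) = del v (del u X)"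
      using \<open>u \<noteq> v\<close> less.prems(3)
      by (simp_all add: lk_lk_commute[of v u] lk_del_commute[of v u]
          lk_del_commute[of u v, symmetric] del_del_commute[of v u])
    have down_lk: "\<tau> \<in> lk u X" if "\<sigma> \<in> lk u X" "\<tau> \<subseteq> \<sigma>" for \<sigma> \<tau>
    proof -
      have "insert u \<tau> \<subseteq> insert u \<sigma>" using that by auto
      then show ?thesis using that less.prems(2) unfolding lk_def by blast
    qed
    have down_del: "\<tau> \<in> del u X" if "\<sigma> \<in> del u X" "\<tau> \<subseteq> \<sigma>" for \<sigma> \<tau>
      using that less.prems(2) unfolding del_def by blast
    show ?thesis
      using less.hyps[OF small(1) fin(1) down_lk cone(1)]
        less.hyps[OF small(2) fin(2) down_del cone(2)] \<open>u \<noteq> v\<close>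
      by (simp add: lk_del_commute del_del_commute)
  qed
  then have img: "(\<lambda>u. max (M0 (lk u X) + 1) (M0 (del u X))) ` non_cone_vertices X =
      (\<lambda>u. max (M0 (lk u (del v X)) + 1) (M0 (del u (del v X)))) ` non_cone_vertices X"
    by (intro image_cong) auto
  have "finite (del v X)"
    using less.prems(1) by (simp add: del_def)
  then show ?case
    using less.prems(1) unfolding M0.simps[of X] M0.simps[of "del v X"] nc img by simp
qed

section \<open>Minimal exclusion sequences under deletion and link\<close>

text \<open>The last hypothesis keeps every \<open>\<gamma> - \<sigma>\<close> nonempty, so
  \<open>Min\<close> is never applied to the empty set.\<close>

lemma mes_extend_subset:
  assumes "finite \<gamma>" and "set vs \<subseteq> \<gamma>" and "\<forall>\<sigma>\<in>set L. \<not> \<gamma> \<subseteq> \<sigma>"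
  shows "set (mes_extend \<gamma> vs L) \<subseteq> \<gamma>"
  using assms
proof (induction L arbitrary: vs)
  case (Cons \<sigma> L)
  have "Min (\<gamma> - \<sigma>) \<in> \<gamma> - \<sigma>"
    using Cons.prems by (intro Min_in) auto
  moreover have "Min (set vs \<inter> (\<gamma> - \<sigma>)) \<in> set vs \<inter> (\<gamma> - \<sigma>)" if "set vs \<inter> (\<gamma> - \<sigma>) \<noteq> {}"
    using that by (intro Min_in) auto
  ultimately show ?case
    unfolding mes_extend.simps using Cons.prems by (intro Cons.IH) auto
qed simp

lemma mes_vertices_subset: "finite \<gamma> \<Longrightarrow> mes_vertices \<gamma> L \<subseteq> \<gamma>"
  unfolding mes_vertices_def mes_def by (rule mes_extend_subset) (auto dest: set_takeWhileD)

text \<open>Generators enter the sequence only through \<open>\<gamma> - \<sigma>\<close>, which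
  removing \<open>v\<close> from \<open>\<sigma>\<close> does not affect. Generators that become
  equal or nested are harmless.\<close>

lemma mes_vertices_del:
  assumes "v \<notin> \<gamma>"
  shows "mes_vertices \<gamma> (map (\<lambda>\<sigma>. \<sigma> - {v}) L) = mes_vertices \<gamma> L"
proof -
  have "mes_extend \<gamma> vs (takeWhile (\<lambda>\<sigma>. \<not> \<gamma> \<subseteq> \<sigma>) (map (\<lambda>\<sigma>. \<sigma> - {v}) L)) =
      mes_extend \<gamma> vs (takeWhile (\<lambda>\<sigma>. \<not> \<gamma> \<subseteq> \<sigma>) L)" for vs
  proof (induction L arbitrary: vs)
    case (Cons \<sigma> L)
    have "\<gamma> - (\<sigma> - {v}) = \<gamma> - \<sigma>" "\<gamma> \<subseteq> \<sigma> - {v} \<longleftrightarrow> \<gamma> \<subseteq> \<sigma>"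
      using assms by auto
    then show ?case by (simp add: Cons.IH)
  qed simp
  then show ?thesis by (simp add: mes_vertices_def mes_def)
qed

text \<open>The two sequences can differ in length, as the link drops generators. They are therefore
  compared as sets, which suffices because each new entry depends only on the set of earlier
  ones.\<close>

lemma mes_extend_lk:
  assumes "v \<notin> \<gamma>" and "set vs = insert v (set ws)"
  shows "set (mes_extend (insert v \<gamma>) vs (takeWhile (\<lambda>\<sigma>. \<not> insert v \<gamma> \<subseteq> \<sigma>) L)) =
    insert v (set (mes_extend \<gamma> ws (takeWhile (\<lambda>\<sigma>. \<not> \<gamma> \<subseteq> \<sigma>)
      (map (\<lambda>\<sigma>. \<sigma> - {v}) (filter (\<lambda>\<sigma>. v \<in> \<sigma>) L)))))"
  using assms(2)
proof (induction L arbitrary: vs ws)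
  case (Cons \<sigma> L)
  show ?case
  proof (cases "v \<in> \<sigma>")
    case True
    then have "insert v \<gamma> - \<sigma> = \<gamma> - (\<sigma> - {v})" "insert v \<gamma> \<subseteq> \<sigma> \<longleftrightarrow> \<gamma> \<subseteq> \<sigma> - {v}"
      "set vs \<inter> (\<gamma> - (\<sigma> - {v})) = set ws \<inter> (\<gamma> - (\<sigma> - {v}))"
      using assms(1) Cons.prems by auto
    then show ?thesis
      using True Cons.prems by (simp add: Cons.IH insert_commute del: insert_subset)
  next
    case False
    let ?m = "Min (set vs \<inter> (insert v \<gamma> - \<sigma>))"
    \<comment> \<open>The old entry \<open>v\<close> lies outside this generator, so the first
      branch applies. The chosen minimum need not be \<open>v\<close>, but it repeats an old
      entry.\<close>
    have ne: "set vs \<inter> (insert v \<gamma> - \<sigma>) \<noteq> {}"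
      using False Cons.prems by auto
    then have "?m \<in> set vs \<inter> (insert v \<gamma> - \<sigma>)"
      by (intro Min_in) auto
    then have "set (vs @ [?m]) = insert v (set ws)"
      using Cons.prems by auto
    then show ?thesis
      using ne False Cons.IH by simp
  qed
qed (simp add: assms)

text \<open>The generator \<open>\<sigma>\<close> is filtered out of the link list. Its only effect
  is the first entry \<open>v\<close>, which gives the starting sequences \<open>[v]\<close> and
  \<open>[]\<close>.\<close>

lemma mes_vertices_lk:
  assumes "v \<notin> \<gamma>" and "v \<notin> \<sigma>" and "Min (insert v \<gamma> - \<sigma>) = v"
  shows "mes_vertices (insert v \<gamma>) (\<sigma> # L) =
    insert v (mes_vertices \<gamma> (map (\<lambda>\<sigma>. \<sigma> - {v}) (filter (\<lambda>\<sigma>. v \<in> \<sigma>) (\<sigma> # L))))"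
  using assms mes_extend_lk[OF assms(1), of "[v]" "[]" L]
  by (simp add: mes_vertices_def mes_def)

section \<open>The induction on generated complexes\<close>

text \<open>Induction is on the size of the complex, since deletion keeps the length of the list.
  The bound \<open>d\<close> varies because the link is treated with \<open>d - 1\<close>.\<close>

lemma M0_generated_complex_le:
  fixes L :: "'a::linorder set list"
  assumes "\<forall>\<sigma>\<in>set L. finite \<sigma>"
    and "\<forall>\<gamma>\<in>generated_complex L. card (mes_vertices \<gamma> L) \<le> d"
  shows "M0 (generated_complex L) \<le> d"
  using assms
proof (induction "card (generated_complex L)" arbitrary: L d rule: less_induct)
  case less
  define X where "X = generated_complex L"
  have finX: "finite X"
    using less.prems(1) by (simp add: X_def finite_generated_complex)
  have down: "\<tau> \<in> X" if "\<sigma> \<in> X" "\<tau> \<subseteq> \<sigma>" for \<sigma> \<tau>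
    using that by (auto simp: X_def generated_complex_def)
  have V: "vertices X = \<Union>(set L)"
    by (auto simp: X_def vertices_def generated_complex_def)
  then have finV: "finite (vertices X)"
    using less.prems(1) by simp
  show ?case
  proof (cases L)
    case Nil
    then show ?thesis
      by (subst M0.simps) (simp add: generated_complex_def non_cone_vertices_def vertices_def)
  next
    case (Cons \<sigma> L')
    show ?thesis
    proof (cases "vertices X \<subseteq> \<sigma>")
      case True
      then have "\<forall>\<rho>\<in>set L. \<rho> \<subseteq> \<sigma>"
        unfolding V by blast
      then have "X = Pow \<sigma>"
        unfolding X_def generated_complex_def Cons by auto
      then have "non_cone_vertices X = {}"
        by (auto simp: non_cone_vertices_def vertices_def lk_def del_def)
      then show ?thesis
        by (subst M0.simps) (simp add: X_def)
    next
      case False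
      define v where "v = Min (vertices X - \<sigma>)"
      have v: "v \<in> vertices X" "v \<notin> \<sigma>"
        using Min_in[of "vertices X - \<sigma>"] False finV by (auto simp: v_def)
      have "lk v X \<subset> X" "del v X \<subset> X"
        using v by (auto simp: vertices_def lk_def del_def)
      then have small: "card (lk v X) < card X" "card (del v X) < card X"
        using finX by (auto intro: psubset_card_mono)
      let ?D = "map (\<lambda>\<sigma>. \<sigma> - {v}) L"
      let ?K = "map (\<lambda>\<sigma>. \<sigma> - {v}) (filter (\<lambda>\<sigma>. v \<in> \<sigma>) L)"
      have D: "del v X = generated_complex ?D" and K: "lk v X = generated_complex ?K"
        by (simp_all add: X_def del_generated_complex lk_generated_complex)
      have del_le: "M0 (del v X) \<le> d"
        unfolding D
      proof (rule less.hyps)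
        show "\<forall>\<gamma>\<in>generated_complex ?D. card (mes_vertices \<gamma> ?D) \<le> d"
          unfolding D[symmetric] using less.prems(2)
          by (auto simp: del_def mes_vertices_del X_def)
      qed (use small D less.prems in \<open>auto simp: X_def\<close>)
      show ?thesis
      proof (cases "v \<in> non_cone_vertices X")
        case True
        have card_lk: "card (mes_vertices \<gamma> ?K) + 1 \<le> d" if "\<gamma> \<in> lk v X" for \<gamma>
        proof -
          have \<gamma>: "v \<notin> \<gamma>" "insert v \<gamma> \<in> X"
            using that by (auto simp: lk_def)
          then have sub: "insert v \<gamma> \<subseteq> vertices X"
            unfolding vertices_def by blast
          then have fin: "finite \<gamma>"
            using finV by (meson finite_insert finite_subset)
          \<comment> \<open>All elements here are vertices of \<open>X\<close> outside
            \<open>\<sigma>\<close>, and \<open>v\<close> was chosen least among those.\<close>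
          have "Min (insert v \<gamma> - \<sigma>) = v"
          proof (rule Min_eqI)
            show "v \<le> u" if "u \<in> insert v \<gamma> - \<sigma>" for u
              unfolding v_def using that sub finV by (intro Min_le) auto
          qed (use fin v in auto)
          then have "mes_vertices (insert v \<gamma>) L = insert v (mes_vertices \<gamma> ?K)"
            unfolding Cons using \<gamma>(1) v(2) by (intro mes_vertices_lk)
          moreover have "v \<notin> mes_vertices \<gamma> ?K"
            using \<gamma>(1) mes_vertices_subset[OF fin] by blast
          moreover have "finite (mes_vertices \<gamma> ?K)"
            by (simp add: mes_vertices_def)
          ultimately have "card (mes_vertices (insert v \<gamma>) L) = card (mes_vertices \<gamma> ?K) + 1"
            by simp
          then show ?thesis
            using less.prems(2) \<gamma>(2) by (metis X_def)
        qed
        \<comment> \<open>The empty simplex of the link forces \<open>d\<close> to be positive, so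
          the truncated subtraction \<open>d - 1\<close> is a true one.\<close>
        obtain \<rho> where "\<rho> \<in> X" "v \<in> \<rho>"
          using v(1) by (auto simp: vertices_def)
        then have "{} \<in> lk v X"
          using down by (auto simp: lk_def)
        then have "d \<ge> 1"
          using card_lk by fastforce
        have "M0 (lk v X) \<le> d - 1"
          unfolding K
        proof (rule less.hyps)
          show "\<forall>\<gamma>\<in>generated_complex ?K. card (mes_vertices \<gamma> ?K) \<le> d - 1"
            unfolding K[symmetric] using card_lk by fastforce
        qed (use small K less.prems in \<open>auto simp: X_def\<close>)
        moreover have "finite (non_cone_vertices X)"
          using finV by (simp add: non_cone_vertices_def)
        ultimately show ?thesis
          using M0_le_max[OF finX True] del_le \<open>d \<ge> 1\<close> by (simp add: X_def)
      next
        case False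
        then have "lk v X = del v X"
          using v(1) by (simp add: non_cone_vertices_def)
        then have "M0 X = M0 (del v X)"
          using finX down by (intro M0_del_cone_point)
        then show ?thesis
          using del_le by (simp add: X_def)
      qed
    qed
  qed
qed

theorem proposition3p19:
  fixes X :: "'a::linorder set set" and \<gamma>s :: "'a set list"
  assumes "simplicial_complex X"
    and "maximal_simplex_order X \<gamma>s"
  shows "M0 X \<le> mes_dim X \<gamma>s"
proof -
  have X: "generated_complex \<gamma>s = X"
    using assms by (intro generated_complex_eq_complex) (auto simp: maximal_simplex_order_def)
  have "finite X" "\<forall>\<sigma>\<in>set \<gamma>s. finite \<sigma>"
    using assms
    by (auto simp: simplicial_complex_def maximal_simplex_order_def maximal_simplices_def)
  \<comment> \<open>For the void complex \<open>mes_dim\<close> is an unspecified \<open>Max\<close>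
    of the empty set, but this bound is then vacuous.\<close>
  moreover have "\<forall>\<gamma>\<in>X. card (mes_vertices \<gamma> \<gamma>s) \<le> mes_dim X \<gamma>s"
    using \<open>finite X\<close> by (auto simp: mes_dim_def)
  ultimately show ?thesis
    using M0_generated_complex_le[of \<gamma>s] X by simp
qed

end
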